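(* $\mathrm{KT}(\aleph_0)$ implies $\mathfrak{c}^\exists\le\mathfrak{d}$.
   Context: All ultrafilters are nonprincipal. $\mathrm{KT}(\aleph_0)$ is the statement: for every countable first-order language $L$ and all $L$-structures $\mathcal{A},\mathcal{B}$ of size $\le\aleph_0$ with $\mathcal{A}\equiv\mathcal{B}$, there exists a nonprincipal ultrafilter $U$ over $\omega$ with $\mathcal{A}^\omega/U\cong\mathcal{B}^\omega/U$. $\mathfrak{d}$ is the least size of a family $D\subseteq\omega^\omega$ such that every $f\in\omega^\omega$ satisfies $f<^*g$ for some $g\in D$ ($f<^*g$: $f(n)<g(n)$ for all but finitely many $n$). For $c,h\in\omega^\omega$ let $\prod c=\prod_n c(n)$ and $S(c,h)=\prod_n[c(n)]^{\le h(n)}$; $\mathfrak{c}^\exists_{c,h}$ is the least size of a family $\Phi\subseteq S(c,h)$ such that for every $x\in\prod c$ there is $\varphi\in\Phi$ with $x(n)\in\varphi(n)$ for infinitely many $n$. Then $\mathfrak{c}^\exists=\min\{\mathfrak{c}^\exists_{c,h}: c,h\in\omega^\omega,\ \sum_n h(n)/c(n)<\infty\}$. *)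

theory Defs
  imports Complex_Main "HOL-Library.FuncSet" "HOL-Library.Infinite_Set"
begin

unbundle cardinal_syntax

record ('f, 'r) language =
  fun_syms :: "'f set"
  rel_syms :: "'r set"
  fun_arity :: "'f \<Rightarrow> nat"
  rel_arity :: "'r \<Rightarrow> nat"

record ('f, 'r, 'a) struct =
  univ :: "'a set"
  fun_interp :: "'f \<Rightarrow> 'a list \<Rightarrow> 'a"
  rel_interp :: "'r \<Rightarrow> 'a list \<Rightarrow> bool"

definition tuples :: "'a set \<Rightarrow> nat \<Rightarrow> 'a list set" where
  "tuples X n = {xs. length xs = n \<and> set xs \<subseteq> X}"

text \<open>Constant symbols are function symbols of arity 0. Interpretations of symbols outside the
  language, and values on lists that are not tuples of the right length over the universe, are
  irrelevant.\<close>

definition is_structure :: "('f, 'r) language \<Rightarrow> ('f, 'r, 'a) struct \<Rightarrow> bool" where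
  "is_structure L A \<longleftrightarrow> univ A \<noteq> {} \<and>
     (\<forall>s \<in> fun_syms L. \<forall>xs \<in> tuples (univ A) (fun_arity L s). fun_interp A s xs \<in> univ A)"

datatype 'f trm = Var nat | Fn 'f "'f trm list"

datatype ('f, 'r) form =
    Eq "'f trm" "'f trm"
  | Rel 'r "'f trm list"
  | Neg "('f, 'r) form"
  | Conj "('f, 'r) form" "('f, 'r) form"
  | Exists nat "('f, 'r) form"

primrec wf_trm :: "('f, 'r) language \<Rightarrow> 'f trm \<Rightarrow> bool" where
  "wf_trm L (Var x) \<longleftrightarrow> True"
| "wf_trm L (Fn s ts) \<longleftrightarrow>
     s \<in> fun_syms L \<and> length ts = fun_arity L s \<and> (\<forall>b \<in> set (map (wf_trm L) ts). b)"

primrec wf_form :: "('f, 'r) language \<Rightarrow> ('f, 'r) form \<Rightarrow> bool" where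
  "wf_form L (Eq t u) \<longleftrightarrow> wf_trm L t \<and> wf_trm L u"
| "wf_form L (Rel r ts) \<longleftrightarrow>
     r \<in> rel_syms L \<and> length ts = rel_arity L r \<and> (\<forall>t \<in> set ts. wf_trm L t)"
| "wf_form L (Neg p) \<longleftrightarrow> wf_form L p"
| "wf_form L (Conj p q) \<longleftrightarrow> wf_form L p \<and> wf_form L q"
| "wf_form L (Exists x p) \<longleftrightarrow> wf_form L p"

primrec fv_trm :: "'f trm \<Rightarrow> nat set" where
  "fv_trm (Var x) = {x}"
| "fv_trm (Fn s ts) = \<Union> (set (map fv_trm ts))"

primrec fv :: "('f, 'r) form \<Rightarrow> nat set" where
  "fv (Eq t u) = fv_trm t \<union> fv_trm u"
| "fv (Rel r ts) = (\<Union>t \<in> set ts. fv_trm t)"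
| "fv (Neg p) = fv p"
| "fv (Conj p q) = fv p \<union> fv q"
| "fv (Exists x p) = fv p - {x}"

definition sentence :: "('f, 'r) language \<Rightarrow> ('f, 'r) form \<Rightarrow> bool" where
  "sentence L p \<longleftrightarrow> wf_form L p \<and> fv p = {}"

primrec val :: "('f, 'r, 'a) struct \<Rightarrow> (nat \<Rightarrow> 'a) \<Rightarrow> 'f trm \<Rightarrow> 'a" where
  "val A e (Var x) = e x"
| "val A e (Fn s ts) = fun_interp A s (map (val A e) ts)"

primrec sat :: "('f, 'r, 'a) struct \<Rightarrow> (nat \<Rightarrow> 'a) \<Rightarrow> ('f, 'r) form \<Rightarrow> bool" where
  "sat A e (Eq t u) \<longleftrightarrow> val A e t = val A e u"
| "sat A e (Rel r ts) \<longleftrightarrow> rel_interp A r (map (val A e) ts)"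
| "sat A e (Neg p) \<longleftrightarrow> \<not> sat A e p"
| "sat A e (Conj p q) \<longleftrightarrow> sat A e p \<and> sat A e q"
| "sat A e (Exists x p) \<longleftrightarrow> (\<exists>a \<in> univ A. sat A (e(x := a)) p)"

definition models :: "('f, 'r, 'a) struct \<Rightarrow> ('f, 'r) form \<Rightarrow> bool" where
  "models A p \<longleftrightarrow> (\<forall>e. range e \<subseteq> univ A \<longrightarrow> sat A e p)"

definition elem_equiv ::
    "('f, 'r) language \<Rightarrow> ('f, 'r, 'a) struct \<Rightarrow> ('f, 'r, 'b) struct \<Rightarrow> bool" where
  "elem_equiv L A B \<longleftrightarrow> (\<forall>p. sentence L p \<longrightarrow> models A p = models B p)"

definition isomorphic ::
    "('f, 'r) language \<Rightarrow> ('f, 'r, 'a) struct \<Rightarrow> ('f, 'r, 'b) struct \<Rightarrow> bool" where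
  "isomorphic L A B \<longleftrightarrow> (\<exists>i. bij_betw i (univ A) (univ B) \<and>
     (\<forall>s \<in> fun_syms L. \<forall>xs \<in> tuples (univ A) (fun_arity L s).
        i (fun_interp A s xs) = fun_interp B s (map i xs)) \<and>
     (\<forall>r \<in> rel_syms L. \<forall>xs \<in> tuples (univ A) (rel_arity L r).
        rel_interp A r xs = rel_interp B r (map i xs)))"

definition ultrafilter :: "'i filter \<Rightarrow> bool" where
  "ultrafilter U \<longleftrightarrow> U \<noteq> bot \<and> (\<forall>P. eventually P U \<or> eventually (\<lambda>n. \<not> P n) U)"

definition nonprincipal :: "'i filter \<Rightarrow> bool" where
  "nonprincipal U \<longleftrightarrow> (\<forall>n. U \<noteq> principal {n})"

definition ae_eq :: "'i filter \<Rightarrow> 'a set \<Rightarrow> (('i \<Rightarrow> 'a) \<times> ('i \<Rightarrow> 'a)) set" where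
  "ae_eq U X = {(f, g). f \<in> UNIV \<rightarrow> X \<and> g \<in> UNIV \<rightarrow> X \<and> (\<forall>\<^sub>F n in U. f n = g n)}"

text \<open>The elements of the ultrapower are equivalence classes \<open>C\<close>; the operations are evaluated
  coordinatewise on representatives \<open>fs\<close> of the argument classes \<open>Cs\<close>. The interpretation of a
  function symbol is the class of the coordinatewise value.\<close>

definition ultrapower ::
    "'i filter \<Rightarrow> ('f, 'r, 'a) struct \<Rightarrow> ('f, 'r, ('i \<Rightarrow> 'a) set) struct" where
  "ultrapower U A = \<lparr>
     univ = (UNIV \<rightarrow> univ A) // ae_eq U (univ A),
     fun_interp = (\<lambda>s Cs. {h \<in> UNIV \<rightarrow> univ A. \<exists>fs. list_all2 (\<in>) fs Cs \<and>
        (\<forall>\<^sub>F n in U. h n = fun_interp A s (map (\<lambda>f. f n) fs))}),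
     rel_interp = (\<lambda>r Cs. \<exists>fs. list_all2 (\<in>) fs Cs \<and>
        (\<forall>\<^sub>F n in U. rel_interp A r (map (\<lambda>f. f n) fs)))\<rparr>"

text \<open>Up to renaming of symbols and isomorphism, the symbols of a countable language are natural
  numbers, and so are the elements of a structure of size at most \<open>\<aleph>\<^sub>0\<close>; the sets of symbols and
  the (nonempty) universes are arbitrary, possibly finite, sets of natural numbers.\<close>

definition KT_aleph0 :: bool where
  "KT_aleph0 \<longleftrightarrow>
     (\<forall>(L :: (nat, nat) language) (A :: (nat, nat, nat) struct) (B :: (nat, nat, nat) struct).
        is_structure L A \<and> is_structure L B \<and> elem_equiv L A B \<longrightarrow>
        (\<exists>U :: nat filter. ultrafilter U \<and> nonprincipal U \<and>
           isomorphic L (ultrapower U A) (ultrapower U B)))"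

text \<open>The least element of a nonempty set of cardinals, unique up to \<open>=o\<close>.\<close>

definition least_card :: "'a rel set \<Rightarrow> 'a rel" where
  "least_card K = (SOME \<kappa>. \<kappa> \<in> K \<and> (\<forall>\<mu> \<in> K. \<kappa> \<le>o \<mu>))"

lemma least_card:
  assumes "K \<noteq> {}" and "\<And>\<kappa>. \<kappa> \<in> K \<Longrightarrow> Card_order \<kappa>"
  shows "least_card K \<in> K" and "\<And>\<mu>. \<mu> \<in> K \<Longrightarrow> least_card K \<le>o \<mu>"
proof -
  have "\<exists>\<kappa>. \<kappa> \<in> K \<and> (\<forall>\<mu> \<in> K. \<kappa> \<le>o \<mu>)"
    using exists_minim_Card_order[of K] assms by blast
  then have "least_card K \<in> K \<and> (\<forall>\<mu> \<in> K. least_card K \<le>o \<mu>)"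
    unfolding least_card_def by (rule someI_ex)
  then show "least_card K \<in> K" and "\<And>\<mu>. \<mu> \<in> K \<Longrightarrow> least_card K \<le>o \<mu>"
    by blast+
qed

definition dominating :: "(nat \<Rightarrow> nat) set \<Rightarrow> bool" where
  "dominating D \<longleftrightarrow> (\<forall>f. \<exists>g \<in> D. \<forall>\<^sub>\<infinity>n. f n < g n)"

definition frak_d :: "(nat \<Rightarrow> nat) rel" where
  "frak_d = least_card {|D| | D. dominating D}"

definition prod_below :: "(nat \<Rightarrow> nat) \<Rightarrow> (nat \<Rightarrow> nat) set" where
  "prod_below c = {x. \<forall>n. x n \<in> {..<c n}}"

definition slaloms :: "(nat \<Rightarrow> nat) \<Rightarrow> (nat \<Rightarrow> nat) \<Rightarrow> (nat \<Rightarrow> nat set) set" where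
  "slaloms c h = {\<phi>. \<forall>n. \<phi> n \<subseteq> {..<c n} \<and> card (\<phi> n) \<le> h n}"

definition io_covering ::
    "(nat \<Rightarrow> nat) \<Rightarrow> (nat \<Rightarrow> nat) \<Rightarrow> (nat \<Rightarrow> nat set) set \<Rightarrow> bool" where
  "io_covering c h \<Phi> \<longleftrightarrow>
     \<Phi> \<subseteq> slaloms c h \<and> (\<forall>x \<in> prod_below c. \<exists>\<phi> \<in> \<Phi>. \<exists>\<^sub>\<infinity>n. x n \<in> \<phi> n)"

definition frak_c_ex_at :: "(nat \<Rightarrow> nat) \<Rightarrow> (nat \<Rightarrow> nat) \<Rightarrow> (nat \<Rightarrow> nat set) rel" where
  "frak_c_ex_at c h = least_card {|\<Phi>| | \<Phi>. io_covering c h \<Phi>}"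

text \<open>The series \<open>\<Sum>n. h n / c n\<close> only makes sense for positive \<open>c\<close>. In Isabelle division by \<open>0\<close>
  yields \<open>0\<close>, and a zero of \<open>c\<close> would make the product empty and the invariant \<open>0\<close>, so positivity
  is explicit. Moreover only pairs for which the cardinal at \<open>(c, h)\<close> is defined contribute to the
  minimum; by \<open>io_covering_exists_iff\<close> below these are the pairs with \<open>h n \<noteq> 0\<close> for infinitely
  many \<open>n\<close>.\<close>

definition frak_c_ex :: "(nat \<Rightarrow> nat set) rel" where
  "frak_c_ex = least_card {frak_c_ex_at c h | c h.
     (\<forall>n. 0 < c n) \<and> summable (\<lambda>n. real (h n) / real (c n)) \<and> (\<exists>\<Phi>. io_covering c h \<Phi>)}"

lemma dominating_UNIV: "dominating UNIV"
  unfolding dominating_def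
proof
  fix f :: "nat \<Rightarrow> nat"
  show "\<exists>g \<in> UNIV. \<forall>\<^sub>\<infinity>n. f n < g n" by (rule bexI[of _ "\<lambda>n. Suc (f n)"]) simp_all
qed

lemma frak_d_attained: "\<exists>D. dominating D \<and> frak_d = |D|"
  and frak_d_le: "dominating D \<Longrightarrow> frak_d \<le>o |D|"
proof -
  let ?K = "{|D| | D. dominating D}"
  have ne: "?K \<noteq> {}" using dominating_UNIV by blast
  have co: "\<And>\<kappa>. \<kappa> \<in> ?K \<Longrightarrow> Card_order \<kappa>"
    by (blast intro: card_of_Card_order)
  show "\<exists>D. dominating D \<and> frak_d = |D|"
    using least_card(1)[OF ne co] unfolding frak_d_def by blast
  show "dominating D \<Longrightarrow> frak_d \<le>o |D|"
    using least_card(2)[OF ne co] unfolding frak_d_def by blast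
qed

lemma io_covering_exists_iff:
  assumes c: "\<forall>n. 0 < c n"
  shows "(\<exists>\<Phi>. io_covering c h \<Phi>) \<longleftrightarrow> (\<exists>\<^sub>\<infinity>n. h n \<noteq> 0)"
proof
  assume "\<exists>\<Phi>. io_covering c h \<Phi>"
  then obtain \<Phi> where \<Phi>: "io_covering c h \<Phi>" ..
  have "(\<lambda>n. 0) \<in> prod_below c" using c by (simp add: prod_below_def)
  with \<Phi> have "\<exists>\<phi> \<in> \<Phi>. \<exists>\<^sub>\<infinity>n. 0 \<in> \<phi> n"
    unfolding io_covering_def by (elim conjE) (drule bspec, assumption)
  then obtain \<phi> where "\<phi> \<in> \<Phi>" and inf: "\<exists>\<^sub>\<infinity>n. 0 \<in> \<phi> n" ..
  then have \<phi>: "\<phi> \<in> slaloms c h" using \<Phi> unfolding io_covering_def by (elim conjE) (rule subsetD)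
  have "h n \<noteq> 0" if "0 \<in> \<phi> n" for n
  proof -
    have "finite (\<phi> n)" "card (\<phi> n) \<le> h n"
      using \<phi> finite_subset[of "\<phi> n" "{..<c n}"] by (auto simp: slaloms_def)
    with that show ?thesis by (metis card_0_eq empty_iff le_zero_eq)
  qed
  then show "\<exists>\<^sub>\<infinity>n. h n \<noteq> 0" by (rule INFM_mono[OF inf])
next
  assume h: "\<exists>\<^sub>\<infinity>n. h n \<noteq> 0"
  have "\<exists>\<phi> \<in> slaloms c h. \<exists>\<^sub>\<infinity>n. x n \<in> \<phi> n" if "x \<in> prod_below c" for x
  proof
    let ?\<phi> = "\<lambda>n. if h n = 0 then {} else {x n}"
    show "?\<phi> \<in> slaloms c h" using that by (auto simp: slaloms_def prod_below_def)
    show "\<exists>\<^sub>\<infinity>n. x n \<in> ?\<phi> n" using h by (rule INFM_mono) simp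
  qed
  then have "io_covering c h (slaloms c h)" unfolding io_covering_def by simp
  then show "\<exists>\<Phi>. io_covering c h \<Phi>" ..
qed

lemma frak_c_ex_at_attained:
    "\<exists>\<Phi>. io_covering c h \<Phi> \<Longrightarrow> \<exists>\<Phi>. io_covering c h \<Phi> \<and> frak_c_ex_at c h = |\<Phi>|"
  and frak_c_ex_at_le: "io_covering c h \<Phi> \<Longrightarrow> frak_c_ex_at c h \<le>o |\<Phi>|"
proof -
  let ?K = "{|\<Phi>| | \<Phi>. io_covering c h \<Phi>}"
  have co: "\<And>\<kappa>. \<kappa> \<in> ?K \<Longrightarrow> Card_order \<kappa>"
    by (blast intro: card_of_Card_order)
  show "\<exists>\<Phi>. io_covering c h \<Phi> \<and> frak_c_ex_at c h = |\<Phi>|" if "\<exists>\<Phi>. io_covering c h \<Phi>"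
  proof -
    have "?K \<noteq> {}" using that by blast
    from least_card(1)[OF this co] show ?thesis unfolding frak_c_ex_at_def by blast
  qed
  show "frak_c_ex_at c h \<le>o |\<Phi>|" if "io_covering c h \<Phi>"
  proof -
    have "?K \<noteq> {}" using that by blast
    from least_card(2)[OF this co] that show ?thesis unfolding frak_c_ex_at_def by blast
  qed
qed

lemma frak_c_ex_attained:
    "\<exists>c h. (\<forall>n. 0 < c n) \<and> summable (\<lambda>n. real (h n) / real (c n)) \<and>
       (\<exists>\<Phi>. io_covering c h \<Phi>) \<and> frak_c_ex = frak_c_ex_at c h"
  and frak_c_ex_le:
    "\<lbrakk>\<forall>n. 0 < c n; summable (\<lambda>n. real (h n) / real (c n)); \<exists>\<Phi>. io_covering c h \<Phi>\<rbrakk>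
       \<Longrightarrow> frak_c_ex \<le>o frak_c_ex_at c h"
proof -
  let ?K = "{frak_c_ex_at c h | c h.
     (\<forall>n. 0 < c n) \<and> summable (\<lambda>n. real (h n) / real (c n)) \<and> (\<exists>\<Phi>. io_covering c h \<Phi>)}"
  have co: "Card_order \<kappa>" if "\<kappa> \<in> ?K" for \<kappa>
  proof -
    from that obtain c h where "\<exists>\<Phi>. io_covering c h \<Phi>" "\<kappa> = frak_c_ex_at c h" by blast
    with frak_c_ex_at_attained[of c h] show ?thesis by (metis card_of_Card_order)
  qed
  have "\<exists>\<Phi>. io_covering (\<lambda>n. 2 ^ n) (\<lambda>n. 1) \<Phi>"
    by (subst io_covering_exists_iff) simp_all
  moreover have "summable (\<lambda>n. real 1 / real (2 ^ n))"
    using summable_geometric[of "1 / 2 :: real"] by (simp add: power_divide)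
  ultimately have "frak_c_ex_at (\<lambda>n. 2 ^ n) (\<lambda>n. 1) \<in> ?K"
    by (intro CollectI exI[of _ "\<lambda>n. 2 ^ n"] exI[of _ "\<lambda>n. 1"]) simp
  then have ne: "?K \<noteq> {}" by blast
  show "\<exists>c h. (\<forall>n. 0 < c n) \<and> summable (\<lambda>n. real (h n) / real (c n)) \<and>
       (\<exists>\<Phi>. io_covering c h \<Phi>) \<and> frak_c_ex = frak_c_ex_at c h"
    using least_card(1)[OF ne co] unfolding frak_c_ex_def by blast
  show "\<lbrakk>\<forall>n. 0 < c n; summable (\<lambda>n. real (h n) / real (c n)); \<exists>\<Phi>. io_covering c h \<Phi>\<rbrakk>
       \<Longrightarrow> frak_c_ex \<le>o frak_c_ex_at c h"
    using least_card(2)[OF ne co] unfolding frak_c_ex_def by blast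
qed

end

theory Submission
  imports Defs "HOL-Library.Countable"
begin

text \<open>
  Let \<open>h i = i + 1\<close> and \<open>c i = (i + 1) 2\<^sup>i\<close>, and let \<open>A\<close> be the structure on the natural numbers
  with the relations \<open>i \<le> j\<close>, \<open>x < c i\<close> and ``\<open>s\<close> codes a subset of \<open>c i\<close> with at most \<open>h i\<close>
  elements, one of which is \<open>x\<close>''. Let \<open>B\<close> be a countable nonstandard model of the theory of \<open>A\<close>,
  with a nonstandard index \<open>b\<close>, in which finitely many points of a nonstandard component always
  lie on a common slalom. Enumerating the countable universe of \<open>B\<close>, a dominating family \<open>D\<close> yields,
  for every index of \<open>B\<^sup>\<omega>/U\<close> above the class of \<open>b\<close>, a family of \<open>|D|\<close> slaloms covering all points
  of that component: the slalom for \<open>d \<in> D\<close> catches at coordinate \<open>n\<close> the first \<open>d n\<close> points.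
  An isomorphism carries this to all indices of \<open>A\<^sup>\<omega>/U\<close> above the class of some \<open>f\<close>, in particular
  to that of \<open>g n = max (f n) n\<close>, and \<open>h (g n) / c (g n) \<le> 2\<^sup>-\<^sup>n\<close> is summable.

  The ultrafilter used to construct \<open>B\<close> is itself supplied by the hypothesis, applied to a trivial
  pair of structures.
\<close>

section \<open>Nonprincipal ultrafilters\<close>

lemma ultrafilter_eventually_not_iff:
  assumes "ultrafilter U"
  shows "eventually (\<lambda>n. \<not> P n) U \<longleftrightarrow> \<not> eventually P U"
proof
  assume "eventually (\<lambda>n. \<not> P n) U"
  show "\<not> eventually P U"
  proof
    assume "eventually P U"
    with \<open>eventually (\<lambda>n. \<not> P n) U\<close> have "eventually (\<lambda>n. False) U"
      by eventually_elim simp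
    then show False using assms by (simp add: ultrafilter_def eventually_False)
  qed
qed (use assms in \<open>auto simp: ultrafilter_def\<close>)

lemma nonprincipal_ultrafilter_neq:
  assumes U: "ultrafilter U" and np: "nonprincipal U"
  shows "eventually (\<lambda>n. n \<noteq> m) U"
proof (rule ccontr)
  assume "\<not> ?thesis"
  then have ev: "eventually (\<lambda>n. n = m) U"
    using ultrafilter_eventually_not_iff[OF U, of "\<lambda>n. n = m"] by simp
  have "eventually P U \<longleftrightarrow> P m" for P
  proof
    assume "eventually P U"
    show "P m"
    proof (rule ccontr)
      assume "\<not> P m"
      from \<open>eventually P U\<close> ev have "eventually (\<lambda>n. False) U"
        by eventually_elim (use \<open>\<not> P m\<close> in auto)
      then show False using U by (simp add: ultrafilter_def eventually_False)
    qed
  next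
    assume "P m"
    with ev show "eventually P U" by (auto elim: eventually_mono)
  qed
  then have "U = principal {m}"
    by (simp add: filter_eq_iff eventually_principal)
  with np show False by (simp add: nonprincipal_def)
qed

text \<open>A cofinite set is a finite intersection of complements of points, each in
  \<open>U\<close>. This turns domination modulo finite sets into a statement about
  \<open>U\<close>-almost all coordinates.\<close>

lemma nonprincipal_ultrafilter_le_cofinite:
  assumes "ultrafilter U" "nonprincipal U"
  shows "U \<le> cofinite"
proof (rule filter_leI)
  fix P :: "'a \<Rightarrow> bool"
  assume "eventually P cofinite"
  then have "finite {n. \<not> P n}" by (simp add: eventually_cofinite)
  then have "eventually (\<lambda>n. \<forall>m \<in> {n. \<not> P n}. n \<noteq> m) U"
    by (rule eventually_ball_finite) (simp add: nonprincipal_ultrafilter_neq[OF assms])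
  then show "eventually P U" by (rule eventually_mono) auto
qed

lemma eventually_ultrafilter_imp_INFM:
  assumes U: "ultrafilter U" "nonprincipal U" and "eventually P U"
  shows "\<exists>\<^sub>\<infinity>n. P n"
proof (rule ccontr)
  assume "\<not> ?thesis"
  then have "\<forall>\<^sub>\<infinity>n. \<not> P n" by (simp add: not_INFM)
  then have "eventually (\<lambda>n. \<not> P n) U"
    by (rule filter_leD[OF nonprincipal_ultrafilter_le_cofinite[OF U]])
  then show False using assms ultrafilter_eventually_not_iff by blast
qed

lemma KT_aleph0_imp_ultrafilter:
  assumes KT_aleph0
  obtains U :: "nat filter" where "ultrafilter U" "nonprincipal U"
proof -
  let ?L = "\<lparr>fun_syms = {}, rel_syms = {}, fun_arity = \<lambda>_. 0, rel_arity = \<lambda>_. 0\<rparr>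
    :: (nat, nat) language"
  let ?A = "\<lparr>univ = UNIV, fun_interp = \<lambda>_ _. 0, rel_interp = \<lambda>_ _. False\<rparr>
    :: (nat, nat, nat) struct"
  have "is_structure ?L ?A" "elem_equiv ?L ?A ?A"
    by (simp_all add: is_structure_def elem_equiv_def)
  with assms that show ?thesis unfolding KT_aleph0_def by blast
qed

section \<open>Relations in ultrapowers\<close>

lemma ae_eq_class_in_ultrapower:
  "f \<in> UNIV \<rightarrow> univ A \<Longrightarrow> ae_eq U (univ A) `` {f} \<in> univ (ultrapower U A)"
  by (auto simp: ultrapower_def intro: quotientI)

lemma ultrapower_cases:
  assumes "C \<in> univ (ultrapower U A)"
  obtains f where "f \<in> UNIV \<rightarrow> univ A" "C = ae_eq U (univ A) `` {f}"
  using assms by (auto simp: ultrapower_def elim: quotientE)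

text \<open>The atomic case of Los's theorem: changing representatives alters finitely many
  arguments on a null set only, so any filter will do.\<close>

lemma rel_interp_ultrapower:
  assumes "set fs \<subseteq> (UNIV \<rightarrow> univ A)"
  shows "rel_interp (ultrapower U A) r (map (\<lambda>f. ae_eq U (univ A) `` {f}) fs) \<longleftrightarrow>
    (\<forall>\<^sub>F n in U. rel_interp A r (map (\<lambda>f. f n) fs))"
    (is "?L \<longleftrightarrow> ?R")
proof
  assume ?L
  then obtain gs where gs: "list_all2 (\<in>) gs (map (\<lambda>f. ae_eq U (univ A) `` {f}) fs)"
    and r: "\<forall>\<^sub>F n in U. rel_interp A r (map (\<lambda>f. f n) gs)"
    by (auto simp: ultrapower_def)
  from gs have "list_all2 (\<lambda>g f. \<forall>\<^sub>F n in U. f n = g n) gs fs"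
    unfolding list_all2_conv_all_nth by (auto simp: ae_eq_def)
  then have "\<forall>\<^sub>F n in U. map (\<lambda>f. f n) fs = map (\<lambda>f. f n) gs"
    by (induction rule: list_all2_induct) (simp_all add: eventually_conj)
  with r show ?R by eventually_elim simp
next
  assume ?R
  moreover have "list_all2 (\<in>) fs (map (\<lambda>f. ae_eq U (univ A) `` {f}) fs)"
    using assms by (auto simp: list_all2_conv_all_nth ae_eq_def dest: nth_mem)
  ultimately show ?L unfolding ultrapower_def by auto
qed

section \<open>Countable elementary submodels of ultrapowers\<close>

lemma finite_fv_trm: "finite (fv_trm t)"
  by (induction t) auto

lemma finite_fv: "finite (fv p)"
  by (induction p) (auto simp: finite_fv_trm)

lemma val_cong_fv: "(\<And>x. x \<in> fv_trm t \<Longrightarrow> e x = e' x) \<Longrightarrow> val A e t = val A e' t"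
proof (induction t)
  case (Fn s ts)
  then have "map (val A e) ts = map (val A e') ts" by fastforce
  then show ?case by (simp only: val.simps)
qed simp

lemma sat_cong_fv: "(\<And>x. x \<in> fv p \<Longrightarrow> e x = e' x) \<Longrightarrow> sat A e p \<longleftrightarrow> sat A e' p"
proof (induction p arbitrary: e e')
  case (Eq t u)
  then show ?case using val_cong_fv[of t e e' A] val_cong_fv[of u e e' A] by simp
next
  case (Rel r ts)
  then have "map (val A e) ts = map (val A e') ts"
    by (auto intro!: val_cong_fv)
  then show ?case by (simp only: sat.simps)
next
  case (Neg p)
  then show ?case by (metis fv.simps(3) sat.simps(3))
next
  case (Conj p q)
  then show ?case by (metis UnCI fv.simps(4) sat.simps(4))
next
  case (Exists x p)
  have "sat A (e(x := a)) p \<longleftrightarrow> sat A (e'(x := a)) p" for a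
    by (rule Exists.IH) (use Exists.prems in auto)
  then show ?case by simp
qed

instance trm :: (countable) countable by countable_datatype
instance form :: (countable, countable) countable by countable_datatype

datatype 'o opterm = Diag | Op 'o "'o opterm list"

instance opterm :: (countable) countable by countable_datatype

primrec opval :: "('o \<Rightarrow> nat list \<Rightarrow> nat) \<Rightarrow> 'o opterm \<Rightarrow> nat \<Rightarrow> nat" where
  "opval H Diag n = n"
| "opval H (Op a ts) n = H a (map (\<lambda>v. v n) (map (opval H) ts))"

text \<open>Terms over countably many operations are countable, and applying an operation to terms
  gives a term. \<open>Diag\<close> yields the identity, the later source of the nonstandard
  index.\<close>

lemma countable_closed_family:
  fixes H :: "'o :: countable \<Rightarrow> nat list \<Rightarrow> nat"
  obtains E :: "nat \<Rightarrow> nat \<Rightarrow> nat" where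
    "\<exists>k. \<forall>n. E k n = n"
    "\<forall>a ks. \<exists>k. \<forall>n. E k n = H a (map (\<lambda>j. E j n) ks)"
proof
  let ?E = "\<lambda>k. opval H (from_nat k)"
  show "\<exists>k. \<forall>n. ?E k n = n"
    by (rule exI[of _ "to_nat (Diag :: 'o opterm)"]) simp
  have "\<exists>k. \<forall>n. ?E k n = H a (map (\<lambda>j. ?E j n) ks)" for a ks
    by (rule exI[of _ "to_nat (Op a (map from_nat ks))"]) (simp add: comp_def)
  then show "\<forall>a ks. \<exists>k. \<forall>n. ?E k n = H a (map (\<lambda>j. ?E j n) ks)" by blast
qed

text \<open>Least indices stand in for classes so that the submodel lives on naturals, as
  \<open>KT_aleph0\<close> demands.\<close>

definition canon :: "nat filter \<Rightarrow> (nat \<Rightarrow> nat \<Rightarrow> nat) \<Rightarrow> nat \<Rightarrow> nat" where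
  "canon V E k = (LEAST j. \<forall>\<^sub>F n in V. E j n = E k n)"

text \<open>The substructure of the ultrapower by \<open>V\<close> formed by the classes of the functions \<open>E k\<close>; each
  class is represented by its least index \<open>k\<close>.\<close>

definition subpower ::
    "nat filter \<Rightarrow> (nat \<Rightarrow> nat \<Rightarrow> nat) \<Rightarrow> ('f, 'r, nat) struct \<Rightarrow> ('f, 'r, nat) struct" where
  "subpower V E A = \<lparr>univ = range (canon V E), fun_interp = (\<lambda>_ _. 0),
     rel_interp = (\<lambda>r ks. \<forall>\<^sub>F n in V. rel_interp A r (map (\<lambda>k. E k n) ks))\<rparr>"

lemma canon_eventually: "\<forall>\<^sub>F n in V. E (canon V E k) n = E k n"
  unfolding canon_def by (rule LeastI[of _ k]) simp

lemma canon_eqI: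
  assumes "\<forall>\<^sub>F n in V. E j n = E k n"
  shows "canon V E j = canon V E k"
proof -
  have "(\<forall>\<^sub>F n in V. E i n = E j n) \<longleftrightarrow> (\<forall>\<^sub>F n in V. E i n = E k n)" for i
  proof
    assume "\<forall>\<^sub>F n in V. E i n = E j n"
    with assms show "\<forall>\<^sub>F n in V. E i n = E k n" by eventually_elim simp
  next
    assume "\<forall>\<^sub>F n in V. E i n = E k n"
    with assms show "\<forall>\<^sub>F n in V. E i n = E j n" by eventually_elim simp
  qed
  then show ?thesis by (simp add: canon_def)
qed

text \<open>\<open>canon\<close> is idempotent, so equality of classes is literal equality of
  canonical indices. This serves the \<open>Eq\<close> case of Los's theorem.\<close>

lemma canon_range_eq_iff:
  assumes "j \<in> range (canon V E)" "k \<in> range (canon V E)"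
  shows "j = k \<longleftrightarrow> (\<forall>\<^sub>F n in V. E j n = E k n)"
proof
  have canon: "canon V E i = i" if "i \<in> range (canon V E)" for i
  proof -
    from that obtain k where k: "i = canon V E k" by auto
    show ?thesis using canon_eqI[of E "canon V E k" k V, OF canon_eventually] by (simp add: k)
  qed
  show "j = k" if "\<forall>\<^sub>F n in V. E j n = E k n"
    using canon_eqI[of E j k V, OF that] canon[OF assms(1)] canon[OF assms(2)] by simp
qed simp

text \<open>Entry \<open>i\<close> of \<open>vs\<close> is the value of variable \<open>i\<close>;
  the default 0 is harmless once the list covers all free variables.\<close>

definition skolem ::
    "('f, 'r, nat) struct \<Rightarrow> ('f, 'r) form \<times> nat \<Rightarrow> nat list \<Rightarrow> nat" where
  "skolem A = (\<lambda>(p, x) vs.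
     LEAST a. sat A ((\<lambda>i. if i < length vs then vs ! i else 0)(x := a)) p)"

text \<open>Los's theorem survives the passage to the submodel because least witnesses, taken
  coordinatewise, form a Skolem function, which has an index by closure.\<close>

lemma Los_subpower:
  assumes V: "ultrafilter V" and A: "univ A = UNIV" and L: "fun_syms L = {}"
    and closed: "\<And>q ks. \<exists>k. \<forall>n. E k n = skolem A q (map (\<lambda>j. E j n) ks)"
    and "wf_form L p" and "range e \<subseteq> range (canon V E)"
  shows "sat (subpower V E A) e p \<longleftrightarrow> (\<forall>\<^sub>F n in V. sat A (\<lambda>i. E (e i) n) p)"
  using assms(5,6)
proof (induction p arbitrary: e)
  case (Eq t u)
  then obtain x y where "t = Var x" "u = Var y"
    using L by (cases t; cases u) auto
  moreover have "e x \<in> range (canon V E)" "e y \<in> range (canon V E)"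
    using Eq.prems(2) by auto
  ultimately show ?case using canon_range_eq_iff[of "e x" V E "e y"] by simp
next
  case (Rel r ts)
  have "val A (\<lambda>i. E (e i) n) t = E (val (subpower V E A) e t) n" if "t \<in> set ts" for t n
  proof (cases t)
    case (Fn s us)
    with that Rel.prems(1) have "wf_trm L (Fn s us)" by auto
    with L show ?thesis by simp
  qed simp
  then have "map (val A (\<lambda>i. E (e i) n)) ts =
      map (\<lambda>k. E k n) (map (val (subpower V E A) e) ts)" for n
    by simp
  then show ?case by (simp only: sat.simps subpower_def struct.simps)
next
  case (Neg p)
  then show ?case using ultrafilter_eventually_not_iff[OF V] by simp
next
  case (Conj p q)
  then show ?case by (simp add: eventually_conj_iff)
next
  case (Exists x p)
  have upd: "(\<lambda>i. E ((e(x := k)) i) n) = (\<lambda>i. E (e i) n)(x := E k n)" for k n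
    by auto
  have IH: "sat (subpower V E A) (e(x := k)) p \<longleftrightarrow>
      (\<forall>\<^sub>F n in V. sat A ((\<lambda>i. E (e i) n)(x := E k n)) p)" if "k \<in> range (canon V E)" for k
  proof -
    have "range (e(x := k)) \<subseteq> range (canon V E)" using Exists.prems(2) that by auto
    from Exists.IH[OF _ this] Exists.prems(1) show ?thesis unfolding upd by (simp del: fun_upd_apply)
  qed
  have univ: "univ (subpower V E A) = range (canon V E)" by (simp add: subpower_def)
  show ?case
  proof
    assume "sat (subpower V E A) e (Exists x p)"
    then obtain k where "k \<in> range (canon V E)" "sat (subpower V E A) (e(x := k)) p"
      by (auto simp: univ)
    then have "\<forall>\<^sub>F n in V. sat A ((\<lambda>i. E (e i) n)(x := E k n)) p" using IH by blast
    then show "\<forall>\<^sub>F n in V. sat A (\<lambda>i. E (e i) n) (Exists x p)"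
      by (rule eventually_mono) (auto simp: A)
  next
    assume ev: "\<forall>\<^sub>F n in V. sat A (\<lambda>i. E (e i) n) (Exists x p)"
    \<comment> \<open>Finitely many parameters suffice, so they fit into one argument list of
      \<open>skolem\<close>.\<close>
    obtain N where N: "fv p \<subseteq> {..<N}" using finite_fv finite_nat_iff_bounded by blast
    obtain k where k: "\<And>n. E k n = skolem A (p, x) (map (\<lambda>j. E j n) (map e [0..<N]))"
      using closed by metis
    have agree: "sat A ((\<lambda>i. E (e i) n)(x := a)) p \<longleftrightarrow>
        sat A ((\<lambda>i. if i < N then map (\<lambda>i. E (e i) n) [0..<N] ! i else 0)(x := a)) p" for n a
      by (rule sat_cong_fv) (use N in auto)
    have least: "E k n = (LEAST a. sat A ((\<lambda>i. E (e i) n)(x := a)) p)" for n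
      unfolding agree k skolem_def by (simp add: comp_def)
    \<comment> \<open>The index \<open>k\<close> itself may lie outside the universe, hence
      \<open>canon V E k\<close>.\<close>
    have "\<forall>\<^sub>F n in V. sat A ((\<lambda>i. E (e i) n)(x := E (canon V E k) n)) p"
      using ev canon_eventually[of E V k]
    proof eventually_elim
      case (elim n)
      then have "\<exists>a. sat A ((\<lambda>i. E (e i) n)(x := a)) p" by auto
      then have "sat A ((\<lambda>i. E (e i) n)(x := E k n)) p" unfolding least by (rule LeastI_ex)
      with elim show ?case by simp
    qed
    then have "sat (subpower V E A) (e(x := canon V E k)) p" using IH by blast
    then show "sat (subpower V E A) e (Exists x p)" by (auto simp: univ)
  qed
qed

lemma elem_equiv_subpower:
  assumes V: "ultrafilter V" and A: "univ A = UNIV" and L: "fun_syms L = {}"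
    and closed: "\<And>q ks. \<exists>k. \<forall>n. E k n = skolem A q (map (\<lambda>j. E j n) ks)"
  shows "elem_equiv L A (subpower V E A)"
  unfolding elem_equiv_def
proof (intro allI impI)
  fix p
  assume p: "sentence L p"
  note Los = Los_subpower[OF assms, of p]
  have univ: "univ (subpower V E A) = range (canon V E)" by (simp add: subpower_def)
  show "models A p \<longleftrightarrow> models (subpower V E A) p"
  proof
    assume "models A p"
    then show "models (subpower V E A) p"
      using Los p by (simp add: models_def A univ sentence_def)
  next
    assume "models (subpower V E A) p"
    then have "\<forall>\<^sub>F n in V. sat A (\<lambda>i. E (canon V E 0) n) p"
      using Los[of "\<lambda>_. canon V E 0"] p by (auto simp: models_def univ sentence_def)
    \<comment> \<open>\<open>V\<close> is proper, so some coordinate satisfies \<open>p\<close>; for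
      a sentence one assignment decides all.\<close>
    then obtain n where "sat A (\<lambda>i. E (canon V E 0) n) p"
      using V eventually_happens' unfolding ultrafilter_def by blast
    moreover have "sat A e p \<longleftrightarrow> sat A e' p" for e e'
      by (rule sat_cong_fv) (use p in \<open>simp add: sentence_def\<close>)
    ultimately show "models A p" by (auto simp: models_def)
  qed
qed

section \<open>The structure of slaloms\<close>

text \<open>Chosen so that \<open>Suc i / width i\<close> is \<open>2^-i\<close>, while the
  permitted slalom size \<open>Suc i\<close> is unbounded.\<close>

definition width :: "nat \<Rightarrow> nat" where "width i = Suc i * 2 ^ i"

definition decode :: "nat \<Rightarrow> nat set" where "decode s = set (from_nat s :: nat list)"

definition is_slalom :: "nat \<Rightarrow> nat \<Rightarrow> bool" where
  "is_slalom i s \<longleftrightarrow> decode s \<subseteq> {..<width i} \<and> card (decode s) \<le> Suc i"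

definition slalom_lang :: "(nat, nat) language" where
  "slalom_lang = \<lparr>fun_syms = {}, rel_syms = {0, 1, 2}, fun_arity = \<lambda>_. 0,
     rel_arity = \<lambda>r. if r = 2 then 3 else 2\<rparr>"

text \<open>Symbol 2 includes the slalom condition, so that codes transferred back from another
  model give genuine slaloms.\<close>

definition slalom_struct :: "(nat, nat, nat) struct" where
  "slalom_struct = \<lparr>univ = UNIV, fun_interp = \<lambda>_ _. 0,
     rel_interp = (\<lambda>r xs. if r = 0 then xs ! 0 \<le> xs ! 1
       else if r = 1 then xs ! 1 < width (xs ! 0)
       else xs ! 1 \<in> decode (xs ! 2) \<and> is_slalom (xs ! 0) (xs ! 2))\<rparr>"

lemma slalom_struct_simps [simp]:
  "univ slalom_struct = UNIV"
  "rel_interp slalom_struct 0 [i, j] \<longleftrightarrow> i \<le> j"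
  "rel_interp slalom_struct (Suc 0) [i, x] \<longleftrightarrow> x < width i"
  "rel_interp slalom_struct 2 [i, x, s] \<longleftrightarrow> x \<in> decode s \<and> is_slalom i s"
  by (simp_all add: slalom_struct_def)

lemma summable_width:
  assumes "\<And>n. n \<le> g n"
  shows "summable (\<lambda>n. real (Suc (g n)) / real (width (g n)))"
proof (rule summable_comparison_test')
  show "summable (\<lambda>n. (1 / 2 :: real) ^ n)" by (rule summable_geometric) simp
  have "real (Suc m) / real (width m) = (1 / 2) ^ m" for m
    unfolding width_def of_nat_mult by (simp add: power_one_over field_simps del: of_nat_Suc)
  then show "norm (real (Suc (g n)) / real (width (g n))) \<le> (1 / 2) ^ n" for n
    using power_decreasing[OF assms, of "1 / 2 :: real" n] by simp
qed

text \<open>Take \<open>b\<close> to be the class of the identity: an index above it exceeds every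
  fixed finite size at almost all coordinates.\<close>

lemma nonstandard_slalom_struct:
  fixes V :: "nat filter"
  assumes V: "ultrafilter V" "nonprincipal V"
  obtains B :: "(nat, nat, nat) struct" and b where
    "is_structure slalom_lang B" "elem_equiv slalom_lang slalom_struct B" "b \<in> univ B"
    "\<forall>i F. rel_interp B 0 [b, i] \<longrightarrow> finite F \<longrightarrow> (\<forall>x \<in> F. rel_interp B 1 [i, x]) \<longrightarrow>
       (\<exists>s \<in> univ B. \<forall>x \<in> F. rel_interp B 2 [i, x, s])"
proof -
  \<comment> \<open>The family is closed under Skolem functions, for elementary equivalence, and under coding of
    finite sets, so that finitely many points of a nonstandard component lie on a slalom.\<close>
  define H :: "((nat, nat) form \<times> nat) option \<Rightarrow> nat list \<Rightarrow> nat" where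
    "H a vs = (case a of None \<Rightarrow> to_nat vs | Some q \<Rightarrow> skolem slalom_struct q vs)" for a vs
  obtain E :: "nat \<Rightarrow> nat \<Rightarrow> nat" where E0: "\<exists>k. \<forall>n. E k n = n"
    and E: "\<forall>a ks. \<exists>k. \<forall>n. E k n = H a (map (\<lambda>j. E j n) ks)"
    using countable_closed_family[of H] .
  obtain d where d: "\<And>n. E d n = n" using E0 by auto
  let ?B = "subpower V E slalom_struct"
  have univ: "univ ?B = range (canon V E)" by (simp add: subpower_def)
  show thesis
  proof (rule that[of ?B "canon V E d"])
    show "is_structure slalom_lang ?B"
      by (simp add: is_structure_def slalom_lang_def univ)
    show "elem_equiv slalom_lang slalom_struct ?B"
    proof (rule elem_equiv_subpower[OF V(1)])
      show "\<exists>k. \<forall>n. E k n = skolem slalom_struct q (map (\<lambda>j. E j n) ks)" for q ks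
        using E[rule_format, of "Some q" ks] by (simp add: H_def)
    qed (simp_all add: slalom_lang_def)
    show "canon V E d \<in> univ ?B" by (simp add: univ)
    show "\<forall>i F. rel_interp ?B 0 [canon V E d, i] \<longrightarrow> finite F \<longrightarrow>
        (\<forall>x \<in> F. rel_interp ?B 1 [i, x]) \<longrightarrow> (\<exists>s \<in> univ ?B. \<forall>x \<in> F. rel_interp ?B 2 [i, x, s])"
    proof (intro allI impI)
      fix i F
      assume i: "rel_interp ?B 0 [canon V E d, i]" and F: "finite F"
        and pts: "\<forall>x \<in> F. rel_interp ?B 1 [i, x]"
      obtain ks where ks: "set ks = F" using finite_list[OF F] by blast
      obtain k where k: "\<And>n. E k n = to_nat (map (\<lambda>j. E j n) ks)"
        using E[rule_format, of None ks] by (auto simp: H_def)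
      have "\<forall>\<^sub>F n in V. E (canon V E d) n \<le> E i n"
        using i by (simp add: subpower_def)
      then have i': "\<forall>\<^sub>F n in V. n \<le> E i n"
        using canon_eventually[of E V d] by eventually_elim (simp add: d)
      have pts': "\<forall>\<^sub>F n in V. \<forall>x \<in> F. E x n < width (E i n)"
        using pts F by (simp add: eventually_ball_finite subpower_def)
      \<comment> \<open>Eventually the fixed length is at most \<open>n\<close>, hence at most
        \<open>E i n\<close>, so a slalom at that index has room for all of
        \<open>F\<close>.\<close>
      have "\<forall>\<^sub>\<infinity>n. length ks \<le> n" by (auto simp: MOST_nat_le)
      then have "\<forall>\<^sub>F n in V. length ks \<le> n"
        by (rule filter_leD[OF nonprincipal_ultrafilter_le_cofinite[OF V]])
      with i' pts' canon_eventually[of E V k]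
      have ev: "\<forall>\<^sub>F n in V. \<forall>x \<in> F. E x n \<in> decode (E (canon V E k) n) \<and>
          is_slalom (E i n) (E (canon V E k) n)"
      proof eventually_elim
        case (elim n)
        have dec: "decode (E k n) = (\<lambda>x. E x n) ` F"
          by (simp add: decode_def k ks)
        have "card ((\<lambda>x. E x n) ` F) \<le> length ks"
          using card_image_le[OF F] card_length[of ks] unfolding ks by (rule order_trans)
        with elim show ?case by (auto simp: is_slalom_def dec)
      qed
      have "rel_interp ?B 2 [i, x, canon V E k]" if "x \<in> F" for x
      proof -
        from ev have "\<forall>\<^sub>F n in V. E x n \<in> decode (E (canon V E k) n) \<and>
            is_slalom (E i n) (E (canon V E k) n)"
          by (rule eventually_mono) (use that in blast)
        then show ?thesis by (simp add: subpower_def)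
      qed
      then show "\<exists>s \<in> univ ?B. \<forall>x \<in> F. rel_interp ?B 2 [i, x, s]"
        using univ by blast
    qed
  qed
qed

section \<open>Transferring slaloms along the isomorphism\<close>

theorem theorem4p1:
  assumes "KT_aleph0"
  shows "frak_c_ex \<le>o frak_d"
proof -
  obtain V :: "nat filter" where V: "ultrafilter V" "nonprincipal V"
    using KT_aleph0_imp_ultrafilter[OF assms] .
  obtain B :: "(nat, nat, nat) struct" and b where B: "is_structure slalom_lang B" "elem_equiv slalom_lang slalom_struct B"
    and b: "b \<in> univ B"
    and catch: "\<forall>i F. rel_interp B 0 [b, i] \<longrightarrow> finite F \<longrightarrow>
       (\<forall>x \<in> F. rel_interp B 1 [i, x]) \<longrightarrow> (\<exists>s \<in> univ B. \<forall>x \<in> F. rel_interp B 2 [i, x, s])"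
    using nonstandard_slalom_struct[OF V] .
  let ?A = slalom_struct
  have "is_structure slalom_lang ?A" by (simp add: is_structure_def slalom_lang_def)
  with assms B obtain U :: "nat filter" where U: "ultrafilter U" "nonprincipal U"
    and isom: "isomorphic slalom_lang (ultrapower U ?A) (ultrapower U B)"
    unfolding KT_aleph0_def by blast
  obtain \<iota> where bij: "bij_betw \<iota> (univ (ultrapower U ?A)) (univ (ultrapower U B))"
    and iso: "\<forall>r \<in> rel_syms slalom_lang.
        \<forall>xs \<in> tuples (univ (ultrapower U ?A)) (rel_arity slalom_lang r).
        rel_interp (ultrapower U ?A) r xs \<longleftrightarrow> rel_interp (ultrapower U B) r (map \<iota> xs)"
    using isom unfolding isomorphic_def by blast
  define clA where "clA f = ae_eq U (univ ?A) `` {f}" for f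
  define clB where "clB f = ae_eq U (univ B) `` {f}" for f
  have clA_univ: "clA f \<in> univ (ultrapower U ?A)" for f
    unfolding clA_def by (rule ae_eq_class_in_ultrapower) simp
  have clB_univ: "clB f \<in> univ (ultrapower U B)" if "f \<in> UNIV \<rightarrow> univ B" for f
    unfolding clB_def by (rule ae_eq_class_in_ultrapower[OF that])
  have onto: "\<exists>f. \<iota> (clA f) = clB g" if "g \<in> UNIV \<rightarrow> univ B" for g
  proof -
    have "clB g \<in> \<iota> ` univ (ultrapower U ?A)"
      using clB_univ[OF that] bij_betw_imp_surj_on[OF bij] by simp
    then obtain C where C: "C \<in> univ (ultrapower U ?A)" "\<iota> C = clB g" by auto
    from C(1) obtain f where "C = clA f" unfolding clA_def by (rule ultrapower_cases)
    with C(2) show ?thesis by blast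
  qed
  have into: "\<exists>g. g \<in> UNIV \<rightarrow> univ B \<and> \<iota> (clA f) = clB g" for f
  proof -
    have "\<iota> (clA f) \<in> univ (ultrapower U B)" using bij clA_univ by (rule bij_betw_apply)
    then show ?thesis unfolding clB_def by (rule ultrapower_cases) blast
  qed
  have transfer: "(\<forall>\<^sub>F n in U. rel_interp ?A r (map (\<lambda>f. f n) fs)) \<longleftrightarrow>
      (\<forall>\<^sub>F n in U. rel_interp B r (map (\<lambda>f. f n) gs))"
    if "r \<in> {0, 1, 2}" "length fs = (if r = 2 then 3 else 2)"
      "map (\<iota> \<circ> clA) fs = map clB gs" "set gs \<subseteq> (UNIV \<rightarrow> univ B)" for r fs gs
    using iso[rule_format, of r "map clA fs"] that clA_univ rel_interp_ultrapower[of fs ?A U r]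
      rel_interp_ultrapower[of gs B U r]
    by (auto simp: slalom_lang_def tuples_def clA_def[abs_def] clB_def[abs_def] comp_def)

  obtain f where f: "\<iota> (clA f) = clB (\<lambda>_. b)" using onto[of "\<lambda>_. b"] b by auto
  \<comment> \<open>Staying above \<open>f\<close> keeps the image of \<open>g\<close> above the
    class of \<open>b\<close>; staying above \<open>n\<close> makes the series summable.\<close>
  define g where "g n = max (f n) n" for n
  obtain g' where g': "g' \<in> UNIV \<rightarrow> univ B" "\<iota> (clA g) = clB g'" using into by blast
  have above: "\<forall>\<^sub>F n in U. rel_interp B 0 [b, g' n]"
    using transfer[of 0 "[f, g]" "[\<lambda>_. b, g']"] f g' b by (simp add: g_def)
  obtain D where D: "dominating D" "frak_d = |D|" using frak_d_attained by blast
  \<comment> \<open>Here \<open>x < m\<close> compares elements of \<open>B\<close> as naturals: it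
    is the enumeration that makes \<open>pts n m\<close> finite, not the order relation of the
    model.\<close>
  define pts where "pts n m = {x \<in> univ B. x < m \<and> rel_interp B 1 [g' n, x]}" for n m :: nat
  \<comment> \<open>The premise inside makes \<open>s\<close> total; it holds at
    \<open>U\<close>-almost all \<open>n\<close> by \<open>above\<close>.\<close>
  have "\<exists>s \<in> univ B. rel_interp B 0 [b, g' n] \<longrightarrow> (\<forall>x \<in> pts n m. rel_interp B 2 [g' n, x, s])"
    for n m
    using catch[rule_format, of "g' n" "pts n m"] b unfolding pts_def by fastforce
  then obtain s where s: "\<And>n m. s n m \<in> univ B"
    "\<And>n m x. \<lbrakk>rel_interp B 0 [b, g' n]; x \<in> pts n m\<rbrakk> \<Longrightarrow> rel_interp B 2 [g' n, x, s n m]"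
    by metis
  have "\<forall>d. \<exists>f. \<iota> (clA f) = clB (\<lambda>n. s n (d n))"
    using onto s(1) by simp
  then obtain t where t: "\<And>d. \<iota> (clA (t d)) = clB (\<lambda>n. s n (d n))"
    by metis
  \<comment> \<open>A preimage \<open>t d\<close> codes slaloms only almost everywhere; the empty
    set elsewhere makes \<open>\<phi> d\<close> a slalom at every coordinate.\<close>
  define \<phi> where "\<phi> d n = (if is_slalom (g n) (t d n) then decode (t d n) else {})" for d n
  have cov: "io_covering (\<lambda>n. width (g n)) (\<lambda>n. Suc (g n)) (\<phi> ` D)"
    unfolding io_covering_def
  proof (intro conjI ballI)
    show "\<phi> ` D \<subseteq> slaloms (\<lambda>n. width (g n)) (\<lambda>n. Suc (g n))"
      by (auto simp: slaloms_def \<phi>_def is_slalom_def split: if_splits)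
    fix x
    assume "x \<in> prod_below (\<lambda>n. width (g n))"
    then have x: "x n < width (g n)" for n by (simp add: prod_below_def)
    obtain x' where x': "x' \<in> UNIV \<rightarrow> univ B" "\<iota> (clA x) = clB x'" using into by blast
    have pt: "\<forall>\<^sub>F n in U. rel_interp B 1 [g' n, x' n]"
      using transfer[of 1 "[g, x]" "[g', x']"] g' x' x by simp
    obtain d where d: "d \<in> D" "\<forall>\<^sub>\<infinity>n. x' n < d n"
      using D(1) unfolding dominating_def by blast
    have "\<forall>\<^sub>F n in U. x' n < d n"
      using filter_leD[OF nonprincipal_ultrafilter_le_cofinite[OF U] d(2)] .
    \<comment> \<open>Domination puts \<open>x' n\<close> among the first \<open>d n\<close> points,
      which \<open>s n (d n)\<close> catches.\<close>
    with above pt have "\<forall>\<^sub>F n in U. rel_interp B 2 [g' n, x' n, s n (d n)]"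
    proof eventually_elim
      case (elim n)
      then show ?case using s(2)[of n "x' n" "d n"] x'(1) by (auto simp: pts_def)
    qed
    then have "\<forall>\<^sub>F n in U. x n \<in> decode (t d n) \<and> is_slalom (g n) (t d n)"
      using transfer[of 2 "[g, x, t d]" "[g', x', \<lambda>n. s n (d n)]"] g' x' t s(1) by simp
    then have "\<forall>\<^sub>F n in U. x n \<in> \<phi> d n" by (rule eventually_mono) (simp add: \<phi>_def)
    then show "\<exists>\<psi> \<in> \<phi> ` D. \<exists>\<^sub>\<infinity>n. x n \<in> \<psi> n"
      using d(1) eventually_ultrafilter_imp_INFM[OF U] by blast
  qed
  have "frak_c_ex \<le>o frak_c_ex_at (\<lambda>n. width (g n)) (\<lambda>n. Suc (g n))"
    using cov by (intro frak_c_ex_le summable_width) (auto simp: g_def width_def)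
  also have "frak_c_ex_at (\<lambda>n. width (g n)) (\<lambda>n. Suc (g n)) \<le>o |\<phi> ` D|"
    by (rule frak_c_ex_at_le[OF cov])
  also have "|\<phi> ` D| \<le>o |D|" by (rule card_of_image)
  finally show ?thesis unfolding D(2) .
qed

end
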